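(* Let $a,b,c,d$ be integers with $\gcd(a,b,c,d)=1$ satisfying $(a+b+c+d)^2=2(a^2+b^2+c^2+d^2)$ (a Descartes quadruple). Then $$|a+b+c|=|\gamma|^2+|\delta|^2$$ for some $\gamma,\delta\in\mathbb Z[\omega]$, where $\omega=(-1+i\sqrt3)/2$, and $$|a+b|=m^2+n^2$$ for some $m,n\in\mathbb Z$. *)

theory Defs
  imports Complex_Main
begin

definition omega :: complex where
  "omega = (-1 + \<i> * complex_of_real (sqrt 3)) / 2"

text \<open>The ring Z[omega] of Eisenstein integers, as a subset of the complex numbers. Since
  omega^2 = -1 - omega, the Z-span of 1 and omega is closed under multiplication.\<close>

definition eisenstein_ints :: "complex set" where
  "eisenstein_ints = {of_int x + of_int y * omega | x y. True}"

end

theory Submission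
  imports Defs
begin

text \<open>
  Write \<open>s = a + b + c\<close>. The Descartes equation is quadratic in \<open>d\<close> and says exactly that
  \<open>d = s + 2 t\<close> with \<open>t\<^sup>2 = a b + b c + c a\<close>. Eliminating one variable from the last equation
  in two ways gives
  \<open>s (a + b) = (a\<^sup>2 + a b + b\<^sup>2) + t\<^sup>2\<close> and \<open>(a + b) (a + c) = a\<^sup>2 + t\<^sup>2\<close>.
  Both right-hand sides have the form \<open>\<bar>z\<bar>\<^sup>2 + \<bar>w\<bar>\<^sup>2\<close>, with \<open>z, w\<close> in \<open>\<int>[\<omega>]\<close> for the first
  and in \<open>\<int>\<close> for the second.

  A pair \<open>(z, w)\<close> of complex numbers is a quaternion \<open>z + w j\<close>, where \<open>j\<^sup>2 = -1\<close> and
  \<open>j z = cnj z j\<close>, and \<open>\<bar>z\<bar>\<^sup>2 + \<bar>w\<bar>\<^sup>2\<close> is its norm. The identities therefore say that the Hermitian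
  matrix with diagonal \<open>A, C\<close> and off-diagonal entry \<open>z + w j\<close> has determinant zero. Over an order
  that is Euclidean for the norm, a positive semidefinite singular matrix without common integer
  divisor factors as column times conjugate row, so \<open>A\<close> and \<open>C\<close> are norms; this is
  \<open>primitive_singular_factorization\<close>, proved by Euclid's algorithm on the diagonal. It applies to
  pairs over \<open>\<int>\<close>, which form the Gaussian integers, and to pairs over \<open>\<int>[\<omega>]\<close>. A common divisor
  of the matrix entries divides \<open>a, b, c\<close> and \<open>t\<close>, hence also \<open>d\<close>, so the matrices are primitive.
\<close>

section \<open>Singular Hermitian matrices over Euclidean quaternion orders\<close>

text \<open>
  The bound in \<open>approx\<close> is what makes the pairs over \<open>R\<close> a Euclidean order: the two components
  of a remainder contribute less than \<open>m\<^sup>2 / 2\<close> each.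
\<close>

locale euclidean_pair_order =
  fixes R :: "complex set"
  assumes one: "1 \<in> R"
    and diff: "\<And>x y. x \<in> R \<Longrightarrow> y \<in> R \<Longrightarrow> x - y \<in> R"
    and mult: "\<And>x y. x \<in> R \<Longrightarrow> y \<in> R \<Longrightarrow> x * y \<in> R"
    and cnj: "\<And>x. x \<in> R \<Longrightarrow> cnj x \<in> R"
    and norm_int: "\<And>x. x \<in> R \<Longrightarrow> (cmod x)^2 \<in> \<int>"
    and approx: "\<And>z m. z \<in> R \<Longrightarrow> m > 0 \<Longrightarrow>
      \<exists>x\<in>R. (cmod (z + of_int m * x))^2 < (of_int m)^2 / 2"
begin

lemma zero: "0 \<in> R"
  using diff[OF one one] by simp

lemma uminus: "x \<in> R \<Longrightarrow> - x \<in> R"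
  using diff[OF zero] by simp

lemma add: "x \<in> R \<Longrightarrow> y \<in> R \<Longrightarrow> x + y \<in> R"
  using diff[of x "- y"] uminus by simp

lemma of_int_mem: "of_int k \<in> R"
proof -
  have nat: "of_nat n \<in> R" for n
    by (induction n) (auto simp: zero one add)
  show ?thesis
    by (cases k) (auto simp: nat uminus simp del: of_nat_Suc)
qed

lemmas closed = zero one add diff uminus mult cnj of_int_mem

text \<open>The trace is the polarisation of the norm between \<open>x\<close> and \<open>1\<close>.\<close>

lemma trace_int:
  assumes "x \<in> R"
  shows "2 * Re x \<in> \<int>"
proof -
  have "2 * Re x = (cmod (x + 1))^2 - (cmod x)^2 - 1"
    unfolding cmod_power2 by (simp add: power2_eq_square algebra_simps)
  then show ?thesis
    using norm_int[OF assms] norm_int[OF add[OF assms one]] by simp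
qed

definition primitive :: "int \<Rightarrow> int \<Rightarrow> complex \<Rightarrow> complex \<Rightarrow> bool" where
  "primitive A C z w \<longleftrightarrow> (\<forall>k. k dvd A \<longrightarrow> k dvd C \<longrightarrow>
     (\<exists>z'\<in>R. z = of_int k * z') \<longrightarrow> (\<exists>w'\<in>R. w = of_int k * w') \<longrightarrow> \<bar>k\<bar> = 1)"

text \<open>
  Adding a multiple of the first row and column to the second changes \<open>z + w j\<close> by a multiple
  of \<open>A\<close>. The new corner entry is again an integer, and divisors common to all entries of the new
  matrix are common to the old one because the operation is invertible and traces are integral.
  The conclusion is stated for the conjugate with the diagonal exchanged, ready for the next step
  of Euclid's algorithm.
\<close>

lemma shift_primitive:
  assumes R: "z \<in> R" "w \<in> R" "x \<in> R" "y \<in> R"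
    and AC: "of_int (A * C) = (cmod z)^2 + (cmod w)^2"
    and prim: "primitive A C z w"
  obtains C' where
    "of_int (A * C') = (cmod (z + of_int A * x))^2 + (cmod (w + of_int A * y))^2"
    "primitive C' A (cnj (z + of_int A * x)) (- (w + of_int A * y))"
proof -
  define tr where "tr u v = 2 * Re (u * cnj x) + 2 * Re (v * cnj y)" for u v
  have tr_int: "tr u v \<in> \<int>" if "u \<in> R" "v \<in> R" for u v
    unfolding tr_def using that R by (intro Ints_add trace_int closed)
  obtain T where T: "tr z w = of_int T"
    using tr_int[OF R(1,2)] by (auto elim: Ints_cases)
  have "(cmod x)^2 + (cmod y)^2 \<in> \<int>"
    using R by (intro Ints_add norm_int)
  then obtain M where M: "(cmod x)^2 + (cmod y)^2 = of_int M"
    by (auto elim: Ints_cases)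
  define C' where "C' = C + T + A * M"
  have expand: "(cmod (u + of_int A * v))^2 =
      (cmod u)^2 + of_int A * (2 * Re (u * cnj v)) + (of_int A)^2 * (cmod v)^2" for u v
    unfolding cmod_power2 by (simp add: power2_eq_square algebra_simps)
  have "(cmod (z + of_int A * x))^2 + (cmod (w + of_int A * y))^2 =
      (cmod z)^2 + (cmod w)^2 + of_int A * tr z w
        + (of_int A)^2 * ((cmod x)^2 + (cmod y)^2)"
    unfolding expand tr_def by (simp add: algebra_simps)
  also have "\<dots> = of_int (A * C')"
    unfolding T M AC[symmetric] C'_def by (simp add: algebra_simps power2_eq_square)
  finally have eq: "of_int (A * C') =
      (cmod (z + of_int A * x))^2 + (cmod (w + of_int A * y))^2" ..
  have "primitive C' A (cnj (z + of_int A * x)) (- (w + of_int A * y))"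
    unfolding primitive_def
  proof (intro allI impI)
    fix k
    assume kC': "k dvd C'" and kA: "k dvd A"
      and "\<exists>z'\<in>R. cnj (z + of_int A * x) = of_int k * z'"
      and "\<exists>w'\<in>R. - (w + of_int A * y) = of_int k * w'"
    then obtain z' w' where z': "z' \<in> R" "cnj (z + of_int A * x) = of_int k * z'"
      and w': "w' \<in> R" "- (w + of_int A * y) = of_int k * w'" by blast
    obtain B where B: "A = k * B" using kA by (auto elim: dvdE)
    define z1 where "z1 = cnj z' - of_int B * x"
    define w1 where "w1 = - w' - of_int B * y"
    have mem: "z1 \<in> R" "w1 \<in> R"
      unfolding z1_def w1_def using z' w' R by (auto intro!: closed)
    have "z + of_int A * x = of_int k * cnj z'"
      using arg_cong[OF z'(2), of cnj] by simp
    then have z1: "z = of_int k * z1"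
      by (simp add: z1_def B algebra_simps)
    have "w + of_int A * y = - (of_int k * w')"
      using w'(2) by (metis minus_minus)
    then have w1: "w = of_int k * w1"
      by (simp add: w1_def B algebra_simps)
    obtain T1 where T1: "tr z1 w1 = of_int T1"
      using tr_int[OF mem] by (auto elim: Ints_cases)
    have "of_int T = of_int k * tr z1 w1"
      unfolding T[symmetric] tr_def z1 w1 by (simp add: algebra_simps)
    then have "T = k * T1"
      unfolding T1 by (metis of_int_eq_iff of_int_mult)
    then have "k dvd C"
      using kC' kA by (metis C'_def dvd_add_left_iff dvd_mult2 dvd_triv_left)
    then show "\<bar>k\<bar> = 1"
      using prim kA mem z1 w1 unfolding primitive_def by blast
  qed
  with eq show ?thesis by (rule that)
qed

lemma quaternion_norm_mult:
  "(cmod (p * r - q * cnj s))^2 + (cmod (p * s + q * cnj r))^2 =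
   ((cmod p)^2 + (cmod q)^2) * ((cmod r)^2 + (cmod s)^2)"
  unfolding cmod_power2 by (simp add: power2_eq_square algebra_simps)

text \<open>
  Reducing \<open>z + w j\<close> modulo \<open>A\<close> makes the other diagonal entry smaller than \<open>A\<close>; exchanging the
  two diagonal entries, which conjugates the quaternion, then continues Euclid's algorithm. It
  ends with a matrix whose only nonzero entry is, by primitivity, a corner entry \<open>1\<close>. Carrying the
  whole factorization \<open>z + w j = (p + q j) (r + s j)\<close> is what allows each step to be undone:
  adding \<open>A (x + y j)\<close> to the left-hand side adds \<open>cnj (p + q j) (x + y j)\<close> to the right factor,
  since \<open>A\<close> is the norm of \<open>p + q j\<close>.
\<close>

theorem primitive_singular_factorization:
  assumes "A \<ge> 0" "C \<ge> 0" "z \<in> R" "w \<in> R"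
    and "of_int (A * C) = (cmod z)^2 + (cmod w)^2"
    and "primitive A C z w"
  shows "\<exists>p\<in>R. \<exists>q\<in>R. \<exists>r\<in>R. \<exists>s\<in>R.
    of_int A = (cmod p)^2 + (cmod q)^2 \<and> of_int C = (cmod r)^2 + (cmod s)^2 \<and>
    z = p * r - q * cnj s \<and> w = p * s + q * cnj r"
  using assms
proof (induction "nat A" arbitrary: A C z w rule: less_induct)
  case less
  note R = \<open>z \<in> R\<close> \<open>w \<in> R\<close> and AC = \<open>of_int (A * C) = (cmod z)^2 + (cmod w)^2\<close>
  show ?case
  proof (cases "A = 0")
    case True
    with AC have zw: "z = 0" "w = 0"
      by (auto simp: add_nonneg_eq_0_iff)
    have "\<bar>C\<bar> = 1"
      using less.prems(6) True zw zero unfolding primitive_def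
      by (metis dvd_0_right dvd_refl mult_zero_right)
    then have "C = 1" using less.prems(2) by simp
    then show ?thesis
      using True zw
      by (intro bexI[of _ 0] bexI[of _ 1]) (auto simp: zero one)
  next
    case False
    then have A: "A > 0" using less.prems(1) by simp
    obtain x y where xy: "x \<in> R" "y \<in> R"
      and x: "(cmod (z + of_int A * x))^2 < (of_int A)^2 / 2"
      and y: "(cmod (w + of_int A * y))^2 < (of_int A)^2 / 2"
      using approx[OF R(1) A] approx[OF R(2) A] by blast
    define z' where "z' = z + of_int A * x"
    define w' where "w' = w + of_int A * y"
    have mem': "z' \<in> R" "w' \<in> R"
      unfolding z'_def w'_def using R xy by (auto intro!: closed)
    obtain C' where C': "of_int (A * C') = (cmod z')^2 + (cmod w')^2"
      and prim': "primitive C' A (cnj z') (- w')"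
      using shift_primitive[OF R xy AC less.prems(6)] unfolding z'_def w'_def by blast
    have "real_of_int (A * C') \<ge> 0"
      unfolding C' by simp
    then have C'0: "C' \<ge> 0"
      using A by (simp add: zero_le_mult_iff)
    have "real_of_int (A * C') < (of_int A)^2"
      unfolding C' z'_def w'_def using x y by simp
    then have "C' < A"
      using A by (simp add: power2_eq_square)
    then have small: "nat C' < nat A"
      using A by simp
    have "\<exists>p\<in>R. \<exists>q\<in>R. \<exists>r\<in>R. \<exists>s\<in>R.
        of_int C' = (cmod p)^2 + (cmod q)^2 \<and> of_int A = (cmod r)^2 + (cmod s)^2 \<and>
        cnj z' = p * r - q * cnj s \<and> - w' = p * s + q * cnj r"
      using less.hyps[OF small C'0 less.prems(1) cnj[OF mem'(1)] uminus[OF mem'(2)]]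
        C' prim' by (simp add: mult.commute)
    then obtain p' q' r' s' where mem: "p' \<in> R" "q' \<in> R" "r' \<in> R" "s' \<in> R"
      and N: "of_int A = (cmod r')^2 + (cmod s')^2"
      and z'_eq: "cnj z' = p' * r' - q' * cnj s'" and w'_eq: "- w' = p' * s' + q' * cnj r'"
      by blast
    \<comment> \<open>Conjugation reverses products, so the factors are conjugated and exchanged.\<close>
    define p where "p = cnj r'"
    define q where "q = - s'"
    define r where "r = cnj p' - (cnj p * x + q * cnj y)"
    define s where "s = - q' - (cnj p * y - q * cnj x)"
    have mems: "p \<in> R" "q \<in> R" "r \<in> R" "s \<in> R"
      unfolding p_def q_def r_def s_def using mem xy by (auto intro!: closed)
    have NA: "of_int A = (cmod p)^2 + (cmod q)^2"
      using N by (simp add: p_def q_def)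
    have NA': "of_int A = p * cnj p + q * cnj q"
      using arg_cong[OF NA, of complex_of_real] unfolding of_real_add complex_norm_square by simp
    have "z' = cnj (p' * r' - q' * cnj s')"
      using z'_eq by (metis complex_cnj_cnj)
    then have "z' = p * cnj p' - q * cnj (- q')"
      by (simp add: p_def q_def algebra_simps)
    then have z: "z = p * r - q * cnj s"
      unfolding z'_def NA' r_def s_def by (simp add: algebra_simps)
    have "w' = - (p' * s' + q' * cnj r')"
      using w'_eq by (metis minus_minus)
    then have "w' = p * (- q') + q * p'"
      by (simp add: p_def q_def algebra_simps)
    then have w: "w = p * s + q * cnj r"
      unfolding w'_def NA' r_def s_def by (simp add: algebra_simps)
    have "real_of_int A * of_int C = of_int A * ((cmod r)^2 + (cmod s)^2)"
      using AC quaternion_norm_mult[of p r q s] by (simp add: NA z w)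
    then have "of_int C = (cmod r)^2 + (cmod s)^2"
      using A by simp
    then show ?thesis
      using mems NA z w by blast
  qed
qed

corollary primitive_divisor_is_norm:
  assumes "z \<in> R" "w \<in> R"
    and eq: "of_int (A * C) = (cmod z)^2 + (cmod w)^2"
    and "primitive A C z w"
  shows "\<exists>p\<in>R. \<exists>q\<in>R. of_int \<bar>A\<bar> = (cmod p)^2 + (cmod q)^2"
proof -
  have "real_of_int (A * C) \<ge> 0" unfolding eq by simp
  then have "\<bar>A\<bar> * \<bar>C\<bar> = A * C" by (simp only: of_int_0_le_iff abs_mult[symmetric] abs_of_nonneg)
  moreover have "primitive \<bar>A\<bar> \<bar>C\<bar> z w"
    using assms(4) by (simp add: primitive_def)
  ultimately show ?thesis
    using primitive_singular_factorization[of "\<bar>A\<bar>" "\<bar>C\<bar>" z w] assms(1,2) eq by fastforce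
qed

end

section \<open>The integers and the Eisenstein integers\<close>

lemma centered_remainder:
  fixes u m :: int
  assumes "m > 0"
  obtains k where "\<bar>2 * (u + m * k)\<bar> \<le> m"
proof -
  define k where "k = - ((2 * u + m) div (2 * m))"
  have "2 * u + m = 2 * m * ((2 * u + m) div (2 * m)) + (2 * u + m) mod (2 * m)"
    by simp
  moreover have "0 \<le> (2 * u + m) mod (2 * m)" "(2 * u + m) mod (2 * m) < 2 * m"
    using assms by auto
  ultimately have "\<bar>2 * (u + m * k)\<bar> \<le> m"
    unfolding k_def by (simp add: algebra_simps)
  then show ?thesis by (rule that)
qed

interpretation integers: euclidean_pair_order \<int>
proof
  fix z :: complex and m :: int
  assume "z \<in> \<int>" "m > 0"
  then obtain u where u: "z = of_int u" by (auto elim: Ints_cases)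
  obtain k where k: "\<bar>2 * (u + m * k)\<bar> \<le> m"
    using centered_remainder[OF \<open>m > 0\<close>] .
  have "4 * (u + m * k)^2 \<le> m^2"
    using power_mono[OF k, of 2] unfolding power2_abs power_mult_distrib by simp
  then have "2 * (u + m * k)^2 < m^2"
    using \<open>m > 0\<close> zero_less_power[of m 2] by linarith
  then have "real_of_int (2 * (u + m * k)^2) < of_int (m^2)"
    by (simp only: of_int_less_iff)
  moreover have "cmod (z + of_int m * of_int k) = \<bar>of_int (u + m * k)\<bar>"
    unfolding u by (metis norm_of_int of_int_add of_int_mult)
  ultimately show "\<exists>x\<in>\<int>. (cmod (z + of_int m * x))^2 < (of_int m)^2 / 2"
    by (intro bexI[of _ "of_int k"]) auto
qed (auto elim!: Ints_cases)

lemma cmod_eisenstein: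
  "(cmod (of_int x + of_int y * omega))^2 = of_int (x^2 - x * y + y^2)"
  unfolding cmod_power2 omega_def
  by (simp add: power2_eq_square algebra_simps add_divide_distrib diff_divide_distrib)

lemma eisenstein_memI: "of_int x + of_int y * omega \<in> eisenstein_ints"
  by (auto simp: eisenstein_ints_def)

lemma of_int_in_eisenstein: "of_int x \<in> eisenstein_ints"
  using eisenstein_memI[of x 0] by simp

lemma omega_square: "omega * omega = - 1 - omega"
  by (simp add: omega_def complex_eq_iff field_simps)

lemma cnj_omega: "cnj omega = - 1 - omega"
  by (simp add: omega_def complex_eq_iff)

lemma eisenstein_eq_iff:
  "of_int x + of_int y * omega = of_int u + of_int v * omega \<longleftrightarrow> x = u \<and> y = v"
  by (auto simp: omega_def complex_eq_iff)

text \<open>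
  The norm of \<open>e + f \<omega>\<close> is \<open>(e - f/2)\<^sup>2 + 3 f\<^sup>2 / 4\<close>. Rounding both coordinates to the nearest
  integer leaves up to \<open>3/4\<close>, which is too much. Rounding \<open>f\<close> first and then choosing \<open>e\<close> closest
  to \<open>f/2\<close> leaves at most \<open>1/4 + 3/16 = 7/16\<close>.
\<close>

interpretation eisenstein: euclidean_pair_order eisenstein_ints
proof
  show "1 \<in> eisenstein_ints"
    using of_int_in_eisenstein[of 1] by simp
next
  fix x y assume "x \<in> eisenstein_ints" "y \<in> eisenstein_ints"
  then obtain x1 x2 y1 y2 where xy: "x = of_int x1 + of_int x2 * omega"
    "y = of_int y1 + of_int y2 * omega" by (auto simp: eisenstein_ints_def)
  have "x - y = of_int (x1 - y1) + of_int (x2 - y2) * omega"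
    by (simp add: xy algebra_simps)
  then show "x - y \<in> eisenstein_ints"
    by (simp only: eisenstein_memI)
  have "x * y = of_int x1 * of_int y1 + (of_int x1 * of_int y2 + of_int x2 * of_int y1) * omega
      + of_int x2 * of_int y2 * (omega * omega)"
    by (simp add: xy algebra_simps)
  also have "\<dots> = of_int (x1 * y1 - x2 * y2) + of_int (x1 * y2 + x2 * y1 - x2 * y2) * omega"
    unfolding omega_square by (simp add: algebra_simps)
  finally show "x * y \<in> eisenstein_ints"
    by (simp only: eisenstein_memI)
next
  fix x assume "x \<in> eisenstein_ints"
  then obtain x1 x2 where x: "x = of_int x1 + of_int x2 * omega"
    by (auto simp: eisenstein_ints_def)
  have "cnj x = of_int (x1 - x2) + of_int (- x2) * omega"
    by (simp add: x cnj_omega algebra_simps)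
  then show "cnj x \<in> eisenstein_ints"
    by (simp only: eisenstein_memI)
  show "(cmod x)^2 \<in> \<int>"
    unfolding x cmod_eisenstein by (rule Ints_of_int)
next
  fix z and m :: int
  assume "z \<in> eisenstein_ints" and m: "m > 0"
  then obtain u v where z: "z = of_int u + of_int v * omega"
    by (auto simp: eisenstein_ints_def)
  obtain l where l: "\<bar>2 * (v + m * l)\<bar> \<le> m"
    using centered_remainder[OF m] .
  define f where "f = v + m * l"
  obtain k where k: "\<bar>2 * ((2 * u - f) + (2 * m) * k)\<bar> \<le> 2 * m"
    using centered_remainder[of "2 * m" "2 * u - f"] m by auto
  define e where "e = u + m * k"
  have "(2 * f)^2 \<le> m^2"
    using power_mono[OF l, of 2] by (simp add: f_def)
  moreover have "\<bar>2 * e - f\<bar> \<le> m"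
    using k unfolding e_def by (simp add: algebra_simps)
  then have "(2 * e - f)^2 \<le> m^2"
    using power_mono[of "\<bar>2 * e - f\<bar>" m 2] by simp
  moreover have "16 * (e^2 - e * f + f^2) = 4 * (2 * e - f)^2 + 3 * (2 * f)^2"
    by (simp add: power2_eq_square algebra_simps)
  ultimately have "2 * (e^2 - e * f + f^2) < m^2"
    using m zero_less_power[of m 2] by linarith
  then have "real_of_int (2 * (e^2 - e * f + f^2)) < of_int (m^2)"
    by (simp only: of_int_less_iff)
  moreover have "z + of_int m * (of_int k + of_int l * omega) = of_int e + of_int f * omega"
    by (simp add: z e_def f_def algebra_simps)
  ultimately have "(cmod (z + of_int m * (of_int k + of_int l * omega)))^2 < (of_int m)^2 / 2"
    by (simp only: cmod_eisenstein) simp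
  then show "\<exists>x\<in>eisenstein_ints. (cmod (z + of_int m * x))^2 < (of_int m)^2 / 2"
    using eisenstein_memI by blast
qed

lemma eisenstein_multiple_dvd:
  assumes "z' \<in> eisenstein_ints" "of_int x + of_int y * omega = of_int k * z'"
  shows "k dvd x \<and> k dvd y"
proof -
  obtain u v where "z' = of_int u + of_int v * omega"
    using assms(1) by (auto simp: eisenstein_ints_def)
  then have "of_int x + of_int y * omega = of_int (k * u) + of_int (k * v) * omega"
    using assms(2) by (simp add: algebra_simps)
  then show ?thesis
    unfolding eisenstein_eq_iff by simp
qed

section \<open>Descartes quadruples\<close>

theorem corollary5p10:
  fixes a b c d :: int
  assumes "Gcd {a, b, c, d} = 1"
    and "(a + b + c + d)^2 = 2 * (a^2 + b^2 + c^2 + d^2)"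
  shows "(\<exists>\<gamma>\<in>eisenstein_ints. \<exists>\<delta>\<in>eisenstein_ints.
            real_of_int \<bar>a + b + c\<bar> = (cmod \<gamma>)^2 + (cmod \<delta>)^2) \<and>
         (\<exists>m n :: int. \<bar>a + b\<bar> = m^2 + n^2)"
proof -
  have sq: "(d - (a + b + c))^2 = 4 * (a * b + b * c + c * a)"
    using assms(2) by (simp add: power2_eq_square algebra_simps)
  then have "even ((d - (a + b + c))^2)"
    by simp
  then have "even (d - (a + b + c))"
    by (simp only: even_power)
  then obtain t where t: "d - (a + b + c) = 2 * t" ..
  then have d: "d = a + b + c + 2 * t" by simp
  have t2: "t^2 = a * b + b * c + c * a"
    using sq unfolding t by (simp add: power_mult_distrib)
  have unit: "\<bar>k\<bar> = 1" if "k dvd a" "k dvd b" "k dvd c" "k dvd t" for k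
  proof -
    have "k dvd Gcd {a, b, c, d}"
      using that by (intro Gcd_greatest) (auto simp: d)
    then show ?thesis unfolding assms(1) by simp
  qed
  have "\<exists>\<gamma>\<in>eisenstein_ints. \<exists>\<delta>\<in>eisenstein_ints.
      real_of_int \<bar>a + b + c\<bar> = (cmod \<gamma>)^2 + (cmod \<delta>)^2"
  proof (rule eisenstein.primitive_divisor_is_norm)
    let ?z = "of_int a + of_int (- b) * omega"
    show "?z \<in> eisenstein_ints" "of_int t \<in> eisenstein_ints"
      by (rule eisenstein_memI of_int_in_eisenstein)+
    have "(a + b + c) * (a + b) = (a^2 - a * (- b) + (- b)^2) + t^2"
      unfolding t2 by (simp add: power2_eq_square algebra_simps)
    then show "real_of_int ((a + b + c) * (a + b)) = (cmod ?z)^2 + (cmod (of_int t))^2"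
      unfolding cmod_eisenstein by simp
    show "eisenstein.primitive (a + b + c) (a + b) ?z (of_int t)"
      unfolding eisenstein.primitive_def
    proof (intro allI impI)
      fix k
      assume "k dvd a + b + c" "k dvd a + b"
        "\<exists>z'\<in>eisenstein_ints. ?z = of_int k * z'"
        "\<exists>w'\<in>eisenstein_ints. of_int t = of_int k * w'"
      moreover from this have "k dvd a" "k dvd b" "k dvd t"
        using eisenstein_multiple_dvd[of _ a "- b" k] eisenstein_multiple_dvd[of _ t 0 k] by auto
      ultimately show "\<bar>k\<bar> = 1"
        using unit dvd_add_right_iff by blast
    qed
  qed
  moreover have "\<exists>p\<in>\<int>. \<exists>q\<in>\<int>. real_of_int \<bar>a + b\<bar> = (cmod p)^2 + (cmod q)^2"
  proof (rule integers.primitive_divisor_is_norm)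
    show "of_int a \<in> (\<int> :: complex set)" "of_int t \<in> (\<int> :: complex set)"
      by auto
    have "(a + b) * (a + c) = a^2 + t^2"
      unfolding t2 by (simp add: power2_eq_square algebra_simps)
    then show "real_of_int ((a + b) * (a + c)) = (cmod (of_int a))^2 + (cmod (of_int t))^2"
      by simp
    have dvd: "k dvd x" if "\<exists>z'\<in>\<int>. (of_int x :: complex) = of_int k * z'" for k x :: int
      using that by (metis Ints_cases dvd_triv_left of_int_eq_iff of_int_mult)
    show "integers.primitive (a + b) (a + c) (of_int a) (of_int t)"
      unfolding integers.primitive_def
      using unit dvd dvd_add_right_iff by blast
  qed
  then obtain m n where "real_of_int \<bar>a + b\<bar> = (cmod (of_int m))^2 + (cmod (of_int n))^2"
    by (auto elim!: Ints_cases)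
  then have "real_of_int \<bar>a + b\<bar> = of_int (m^2 + n^2)"
    by simp
  then have "\<bar>a + b\<bar> = m^2 + n^2"
    by (simp only: of_int_eq_iff)
  ultimately show ?thesis by blast
qed

end
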